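(* Let $d\ge2$. For all $j,k=1,2,\ldots,d$, $$\|\mathcal{J}^{(jk)}\|_{\ell^1(\mathbb{Z}^d)}\le C_d,$$ where $C_d$ is a constant depending on $d$.
   Context: $P_t(x)=(2\pi t)^{-d/2}e^{-|x|^2/(2t)}$ and $H(x,t)=\sum_{n\in\mathbb{Z}^d}P_t(x-n)$ for $x\in\mathbb{R}^d$, $t>0$. For $m\in\mathbb{Z}^d\setminus\{0\}$, $$U(m)=-\frac{1}{\pi^{d/2}\,\Gamma((d+2)/2)}\int_0^\infty\int_{\mathbb{R}^d}\frac{s^{d/2}e^{-s-|z|^2}}{H\left(\frac{z|m|}{2\sqrt{s}}+\frac m2,\ \frac{|m|^2}{4s}\right)}\,dz\,ds.$$ With $c_d=\pi^{-d/2}\Gamma(\frac{d+2}{2})$, define $\mathcal{J}^{(jk)}(m)=c_d\frac{m_jm_k}{|m|^{d+2}}(U(m)+1)$ for $m\in\mathbb{Z}^d\setminus\{0\}$ and $\mathcal{J}^{(jk)}(0)=0$. *)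

theory Defs
  imports "HOL-Analysis.Analysis"
begin

text \<open>
  The dimension is \<open>d = CARD('d)\<close>; points of the lattice are elements of \<^typ>\<open>int ^ 'd\<close>,
  regarded as elements of \<^typ>\<open>real ^ 'd\<close> through the following embedding.
\<close>

definition lattice_vec :: "int ^ 'd \<Rightarrow> real ^ 'd" where
  "lattice_vec m = (\<chi> i. real_of_int (m $ i))"

definition heat_kernel :: "real \<Rightarrow> real ^ 'd \<Rightarrow> real" where
  "heat_kernel t x = (2 * pi * t) powr (- real CARD('d) / 2) * exp (- (norm x)\<^sup>2 / (2 * t))"

definition periodic_heat_kernel :: "real ^ 'd \<Rightarrow> real \<Rightarrow> real" where
  "periodic_heat_kernel x t = (\<Sum>\<^sub>\<infinity>n::int ^ 'd. heat_kernel t (x - lattice_vec n))"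

text \<open>
  The integrand below is positive and dominated by an integrable function, because the terms
  \<open>n = 0\<close> and \<open>n = m\<close> alone give
  \<open>1 / H(z|m|/(2 sqrt s) + m/2, |m|^2/(4s)) \<le> (pi |m|^2/(2s))^(d/2) exp((s + |z|^2)/2)\<close>.
  So the default value 0 of non-convergent Bochner integrals never arises for \<open>m \<noteq> 0\<close>.
\<close>

definition U :: "int ^ 'd \<Rightarrow> real" where
  "U m = - (1 / (pi powr (real CARD('d) / 2) * Gamma ((real CARD('d) + 2) / 2))) *
     (LINT s:{0<..}|lborel. (LINT z|lborel.
        s powr (real CARD('d) / 2) * exp (- s - (norm (z :: real ^ 'd))\<^sup>2) /
        periodic_heat_kernel
          ((norm (lattice_vec m) / (2 * sqrt s)) *\<^sub>R z + (1 / 2) *\<^sub>R lattice_vec m)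
          ((norm (lattice_vec m))\<^sup>2 / (4 * s))))"

definition c_const :: "nat \<Rightarrow> real" where
  "c_const d = pi powr (- real d / 2) * Gamma ((real d + 2) / 2)"

definition J_kernel :: "'d \<Rightarrow> 'd \<Rightarrow> int ^ 'd \<Rightarrow> real" where
  "J_kernel j k m =
     (if m = 0 then 0
      else c_const CARD('d) *
        (real_of_int (m $ j) * real_of_int (m $ k) / norm (lattice_vec m) ^ (CARD('d) + 2)) *
        (U m + 1))"

end

theory Submission
  imports Defs "HOL-Probability.Distributions"
begin

text \<open>
  The Gamma and Gaussian weights in \<open>U\<close> integrate to the normalising constant, so \<open>U m + 1\<close> is
  the average of \<open>1 - 1 / H\<close>.  The periodic heat kernel \<open>H(x, t)\<close> is a product of one-dimensional
  sums of Gaussians over the integers; comparing each half of such a sum with the integral of a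
  monotone function shows that it differs from 1 by at most \<open>2 / sqrt (2 pi t)\<close>.  With
  \<open>t = |m|^2 / (4 s)\<close> this gives \<open>|1 - 1 / H| \<le> K (sqrt s / |m|)\<close> when \<open>sqrt s / |m|\<close> is small;
  otherwise the lower bound on \<open>H\<close> by its single term \<open>n = 0\<close> or \<open>n = m\<close> gives the same estimate
  with an additional factor \<open>exp ((s + |z|^2) / 2)\<close>, which the weights absorb.  Hence
  \<open>|U m + 1| \<le> C / |m|\<close>, the kernel is \<open>O(|m|^(- d - 1))\<close>, and the latter is summable because it is
  dominated by a product of \<open>(1 + |m_i|)^(- 1 - 1 / d)\<close>.
\<close>

section \<open>One-dimensional sums of Gaussians over the integers\<close>

lemma has_sum_int_split:
  fixes f :: "int \<Rightarrow> 'a :: topological_comm_monoid_add"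
  assumes "((\<lambda>k::nat. f (a + int k)) has_sum A) UNIV"
    and "((\<lambda>k::nat. f (a - 1 - int k)) has_sum B) UNIV"
  shows "(f has_sum (A + B)) UNIV"
proof -
  have 1: "(f has_sum A) (range (\<lambda>k::nat. a + int k))"
    by (subst has_sum_reindex) (use assms(1) in \<open>auto simp: inj_def o_def\<close>)
  have 2: "(f has_sum B) (range (\<lambda>k::nat. a - 1 - int k))"
    by (subst has_sum_reindex) (use assms(2) in \<open>auto simp: inj_def o_def\<close>)
  have "n \<in> range (\<lambda>k::nat. a + int k) \<union> range (\<lambda>k::nat. a - 1 - int k)" for n
  proof (cases "n \<ge> a")
    case True
    then have "n = a + int (nat (n - a))" by simp
    then show ?thesis by blast
  next
    case False
    then have "n = a - 1 - int (nat (a - 1 - n))" by simp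
    then show ?thesis by blast
  qed
  then have "range (\<lambda>k::nat. a + int k) \<union> range (\<lambda>k::nat. a - 1 - int k) = UNIV"
    by blast
  with has_sum_Un_disjoint[OF 1 2] show ?thesis by fastforce
qed

text \<open>The integral of \<open>q\<close> over \<open>[a + k, a + k + 1]\<close> lies between
  \<open>q (a + k + 1)\<close> and \<open>q (a + k)\<close>; summing over \<open>k\<close>
  telescopes to \<open>L - F a <= S <= L - F a + q a\<close>. Both \<open>F a\<close> and
  \<open>q a\<close> lie in \<open>[0, q 0]\<close>, so integrating from 0 rather than from
  \<open>a\<close> keeps the error within \<open>q 0\<close>.\<close>

lemma antimono_series_integral_bound:
  fixes q :: "real \<Rightarrow> real"
  assumes anti: "\<And>x y. 0 \<le> x \<Longrightarrow> x \<le> y \<Longrightarrow> q y \<le> q x"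
    and nonneg: "\<And>x. 0 \<le> q x"
    and cont: "continuous_on UNIV q"
    and lim: "((\<lambda>y. integral {0..y} q) \<longlongrightarrow> L) at_top"
    and a: "0 \<le> a" "a \<le> 1"
  shows "\<exists>S. ((\<lambda>k::nat. q (a + real k)) has_sum S) UNIV \<and> \<bar>S - L\<bar> \<le> q 0"
proof -
  define F where "F = (\<lambda>y. integral {0..y} q)"
  have int: "q integrable_on {x..y}" for x y
    by (intro integrable_continuous_real continuous_on_subset[OF cont]) auto
  have F_diff: "F y - F x = integral {x..y} q" if "0 \<le> x" "x \<le> y" for x y
    using Henstock_Kurzweil_Integration.integral_combine[OF that int] by (simp add: F_def)
  have upper: "F y - F x \<le> (y - x) * q x" if "0 \<le> x" "x \<le> y" for x y
    using integral_le[OF int, of "\<lambda>_. q x" x y] that anti by (auto simp: F_diff)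
  have lower: "(y - x) * q y \<le> F y - F x" if "0 \<le> x" "x \<le> y" for x y
    using integral_le[OF _ int, of "\<lambda>_. q y" x y] that anti by (auto simp: F_diff)
  have F0: "F 0 = 0" by (simp add: F_def)
  have Fa: "0 \<le> F a" "F a \<le> q 0"
    using upper[of 0 a] lower[of 0 a] a nonneg[of 0] mult_right_mono[of a 1 "q 0"]
      mult_nonneg_nonneg[OF a(1) nonneg[of a]] F0 by auto
  have limF: "(\<lambda>k. F (a + real k)) \<longlonglongrightarrow> L"
    by (rule filterlim_compose[OF lim[folded F_def]], rule filterlim_tendsto_add_at_top)
       (auto intro: filterlim_real_sequentially)
  then have tel: "(\<lambda>k. F (a + real (Suc k)) - F (a + real k)) sums (L - F (a + real 0))"
    by (rule telescope_sums)
  have step_le: "F (a + real (Suc k)) - F (a + real k) \<le> q (a + real k)"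
    and le_step: "q (a + real (Suc k)) \<le> F (a + real (Suc k)) - F (a + real k)" for k
    using upper[of "a + real k" "a + real (Suc k)"] lower[of "a + real k" "a + real (Suc k)"] a
    by auto
  have sumSuc: "summable (\<lambda>k. q (a + real (Suc k)))"
    by (rule summable_comparison_test[OF _ sums_summable[OF tel]])
       (use le_step nonneg in auto)
  then have summ: "summable (\<lambda>k. q (a + real k))"
    using summable_Suc_iff[of "\<lambda>k. q (a + real k)"] by simp
  define S where "S = (\<Sum>k. q (a + real k))"
  have "L - F a \<le> S"
    using suminf_le[OF step_le sums_summable[OF tel] summ] sums_unique[OF tel] by (simp add: S_def)
  moreover have "(\<Sum>k. q (a + real (Suc k))) \<le> L - F a"
    using suminf_le[OF le_step sumSuc sums_summable[OF tel]] sums_unique[OF tel] by simp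
  then have "S \<le> L - F a + q a"
    using suminf_split_head[OF summ] by (simp add: S_def)
  moreover have "q a \<le> q 0" using anti a by simp
  moreover have "((\<lambda>k::nat. q (a + real k)) has_sum S) UNIV"
    unfolding S_def using summ nonneg by (intro norm_summable_imp_has_sum summable_sums) auto
  ultimately show ?thesis using Fa by (intro exI[of _ S]) auto
qed

text \<open>The density is even with total mass 1. The limit form is the one that
  \<open>antimono_series_integral_bound\<close> takes as hypothesis.\<close>

lemma integral_normal_density_half:
  assumes "\<sigma> > 0"
  shows "((\<lambda>y. integral {0..y} (normal_density 0 \<sigma>)) \<longlongrightarrow> 1 / 2) at_top"
proof -
  let ?g = "\<lambda>x. indicator {0..} x *\<^sub>R normal_density 0 \<sigma> x"
  have int: "integrable lborel ?g"
    using assms by (intro integrable_mult_indicator) auto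
  have "has_bochner_integral lborel (normal_density 0 \<sigma>) (2 *\<^sub>R integral\<^sup>L lborel ?g)"
    by (rule has_bochner_integral_even_function[OF has_bochner_integral_integrable[OF int]])
       (simp add: normal_density_def)
  then have half: "integral\<^sup>L lborel ?g = 1 / 2"
    using has_bochner_integral_integral_eq assms by fastforce
  have "(\<integral>x. indicator {..y} x *\<^sub>R ?g x \<partial>lborel) = integral {0..y} (normal_density 0 \<sigma>)" for y
  proof -
    have "(\<integral>x. indicator {..y} x *\<^sub>R ?g x \<partial>lborel) = (LINT x:{0..y}|lborel. normal_density 0 \<sigma> x)"
      unfolding set_lebesgue_integral_def
      by (rule Bochner_Integration.integral_cong) (auto simp: indicator_def)
    also have "\<dots> = integral {0..y} (normal_density 0 \<sigma>)"
      by (rule set_borel_integral_eq_integral)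
         (unfold set_integrable_def, intro integrable_mult_indicator, use assms in auto)
    finally show ?thesis .
  qed
  with tendsto_integral_at_top[OF _ int] show ?thesis unfolding half by simp
qed

text \<open>The heat kernel of the circle of length 1, a Jacobi theta function. The parameter is the
  standard deviation, so time \<open>t\<close> enters below as \<open>sqrt t\<close>.\<close>

definition theta :: "real \<Rightarrow> real \<Rightarrow> real" where
  "theta \<sigma> y = (\<Sum>\<^sub>\<infinity>n::int. normal_density 0 \<sigma> (y - of_int n))"

text \<open>Cutting the integers between \<open>\<lfloor>y\<rfloor>\<close> and its successor and
  using evenness gives two series of \<open>?q\<close> along \<open>frac y + k\<close> and
  \<open>1 - frac y + k\<close>. Each is within \<open>?q 0\<close>, which is
  \<open>1 / sqrt (2 * pi * \<sigma>\<^sup>2)\<close>, of 1/2.\<close>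

lemma
  assumes "\<sigma> > 0"
  shows summable_on_theta: "(\<lambda>n::int. normal_density 0 \<sigma> (y - of_int n)) summable_on UNIV"
    and theta_close_1: "\<bar>theta \<sigma> y - 1\<bar> \<le> 2 / sqrt (2 * pi * \<sigma>\<^sup>2)"
proof -
  let ?q = "normal_density 0 \<sigma>"
  have anti: "?q w \<le> ?q v" if "0 \<le> v" "v \<le> w" for v w
    using assms that power_mono[of v w 2] by (auto simp: normal_density_def divide_simps)
  have cont: "continuous_on UNIV ?q"
    unfolding normal_density_def using assms by (intro continuous_intros) auto
  have half: "\<exists>S. ((\<lambda>k::nat. ?q (a + real k)) has_sum S) UNIV \<and> \<bar>S - 1 / 2\<bar> \<le> ?q 0"
    if "0 \<le> a" "a \<le> 1" for a
    by (rule antimono_series_integral_bound)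
       (use anti cont integral_normal_density_half[OF assms] that in auto)
  obtain A where A: "((\<lambda>k::nat. ?q (1 - frac y + real k)) has_sum A) UNIV" "\<bar>A - 1 / 2\<bar> \<le> ?q 0"
    using half[of "1 - frac y"] frac_lt_1[of y] frac_ge_0[of y] by auto
  obtain B where B: "((\<lambda>k::nat. ?q (frac y + real k)) has_sum B) UNIV" "\<bar>B - 1 / 2\<bar> \<le> ?q 0"
    using half[of "frac y"] frac_lt_1[of y] frac_ge_0[of y] by auto
  have even: "?q (- v) = ?q v" for v by (simp add: normal_density_def)
  have "?q (y - of_int (\<lfloor>y\<rfloor> + 1 + int k)) = ?q (1 - frac y + real k)" for k
    using even[of "1 - frac y + real k"] by (simp add: frac_def algebra_simps)
  moreover have "?q (y - of_int (\<lfloor>y\<rfloor> + 1 - 1 - int k)) = ?q (frac y + real k)" for k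
    by (simp add: frac_def algebra_simps)
  ultimately have sum: "((\<lambda>n::int. ?q (y - of_int n)) has_sum (A + B)) UNIV"
    using A B by (intro has_sum_int_split[of _ "\<lfloor>y\<rfloor> + 1"]) simp_all
  then show "(\<lambda>n::int. ?q (y - of_int n)) summable_on UNIV"
    by (rule has_sum_imp_summable)
  have "theta \<sigma> y = A + B"
    using sum by (simp add: theta_def infsumI)
  then show "\<bar>theta \<sigma> y - 1\<bar> \<le> 2 / sqrt (2 * pi * \<sigma>\<^sup>2)"
    using A(2) B(2) by (simp add: normal_density_def)
qed

text \<open>Enumerating the integers turns the unordered sum into an ordinary series of measurable
  functions; positivity of \<open>f\<close> supplies the summability that makes the two
  agree.\<close>

lemma measurable_theta [measurable (raw)]:
  assumes [measurable]: "f \<in> borel_measurable M" "g \<in> borel_measurable M"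
    and pos: "\<And>x. x \<in> space M \<Longrightarrow> f x > 0"
  shows "(\<lambda>x. theta (f x) (g x)) \<in> borel_measurable M"
proof -
  have "theta (f x) (g x) = (\<Sum>k::nat. normal_density 0 (f x) (g x - of_int (int_decode k)))"
    if "x \<in> space M" for x
  proof -
    let ?h = "\<lambda>n::int. normal_density 0 (f x) (g x - of_int n)"
    have "theta (f x) (g x) = (\<Sum>\<^sub>\<infinity>k. ?h (int_decode k))"
      unfolding theta_def by (rule infsum_reindex_bij_betw[symmetric]) (rule bij_int_decode)
    moreover have "(\<lambda>k. ?h (int_decode k)) summable_on UNIV"
      using summable_on_theta[OF pos[OF that], of "g x"]
        summable_on_reindex_bij_betw[OF bij_int_decode, of ?h] by simp
    ultimately show ?thesis
      using has_sum_imp_sums[OF has_sum_infsum] sums_unique by metis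
  qed
  then show ?thesis
    unfolding normal_density_def by (subst measurable_cong) auto
qed

section \<open>Factorisation of the periodic heat kernel over the coordinates\<close>

lemma has_sum_prod_vec:
  fixes f :: "'d::finite \<Rightarrow> int \<Rightarrow> real"
  assumes summ: "\<And>i. f i summable_on UNIV" and nonneg: "\<And>i n. 0 \<le> f i n"
  shows "((\<lambda>n :: int ^ 'd. \<Prod>i\<in>UNIV. f i (n $ i)) has_sum (\<Prod>i\<in>UNIV. infsum (f i) UNIV)) UNIV"
proof -
  let ?P = "PiE UNIV (\<lambda>_. UNIV) :: ('d \<Rightarrow> int) set"
  \<comment> \<open>Nonnegativity makes the summability absolute, which allows the product of sums
    to be expanded into a sum over functions; \<open>vec_nth\<close> then carries it to
    vectors.\<close>
  have abs: "(\<lambda>n. norm (f i n)) summable_on UNIV" for i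
    using summ nonneg by simp
  have "(\<lambda>g. \<Prod>i\<in>UNIV. f i (g i)) summable_on ?P"
    using abs_summable_on_prod_PiE[of UNIV "\<lambda>_. UNIV" f] abs
    by (simp add: abs_summable_equivalent[symmetric] nonneg prod_nonneg)
  moreover have "infsum (\<lambda>g. \<Prod>i\<in>UNIV. f i (g i)) ?P = (\<Prod>i\<in>UNIV. infsum (f i) UNIV)"
    using abs by (intro infsum_prod_PiE_abs) auto
  ultimately have *: "((\<lambda>g. \<Prod>i\<in>UNIV. f i (g i)) has_sum (\<Prod>i\<in>UNIV. infsum (f i) UNIV)) ?P"
    by (metis has_sum_infsum)
  have "bij_betw (vec_nth :: int ^ 'd \<Rightarrow> 'd \<Rightarrow> int) UNIV ?P"
    by (auto simp: bij_betw_def inj_def vec_eq_iff fun_eq_iff PiE_UNIV_domain image_def)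
       (metis vec_lambda_beta)
  with * show ?thesis
    using has_sum_reindex_bij_betw[of vec_nth UNIV ?P "\<lambda>g. \<Prod>i\<in>UNIV. f i (g i)"] by simp
qed

text \<open>Each factor is at most 2 because \<open>\<delta> \<le> 1\<close>, so one more factor
  turns an error \<open>E\<close> into at most \<open>2 * E + \<delta>\<close>; starting from 0,
  this recurrence yields \<open>(2 ^ n - 1) * \<delta>\<close>.\<close>

lemma prod_close_1:
  fixes h :: "'i \<Rightarrow> real"
  assumes "finite A" "\<And>i. i \<in> A \<Longrightarrow> \<bar>h i - 1\<bar> \<le> \<delta>" "0 \<le> \<delta>" "\<delta> \<le> 1"
  shows "\<bar>prod h A - 1\<bar> \<le> (2 ^ card A - 1) * \<delta>"
  using assms(1,2)
proof (induction A)
  case (insert i A)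
  have IH: "\<bar>prod h A - 1\<bar> \<le> (2 ^ card A - 1) * \<delta>" using insert by auto
  have hi: "\<bar>h i - 1\<bar> \<le> \<delta>" using insert by auto
  have "\<bar>h i * (prod h A - 1)\<bar> \<le> 2 * ((2 ^ card A - 1) * \<delta>)"
    unfolding abs_mult using hi IH assms(4) by (intro mult_mono) auto
  moreover have "prod h (insert i A) - 1 = h i * (prod h A - 1) + (h i - 1)"
    using insert by (simp add: algebra_simps)
  ultimately have "\<bar>prod h (insert i A) - 1\<bar> \<le> 2 * ((2 ^ card A - 1) * \<delta>) + \<delta>"
    using hi by linarith
  then show ?case using insert by (simp add: algebra_simps)
qed simp

lemma power2_norm_vec: "(norm x)\<^sup>2 = (\<Sum>i\<in>UNIV. (x $ i)\<^sup>2)" for x :: "real ^ 'd"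
  by (simp add: norm_vec_def L2_set_def sum_nonneg)

lemma heat_kernel_eq_prod:
  fixes x :: "real ^ 'd"
  assumes "t > 0"
  shows "heat_kernel t x = (\<Prod>i\<in>UNIV. normal_density 0 (sqrt t) (x $ i))"
proof -
  have "(2 * pi * t) powr (- real CARD('d) / 2) = (1 / sqrt (2 * pi * t)) ^ CARD('d)"
    using assms by (simp add: powr_half_sqrt[symmetric] powr_minus_divide powr_power power_divide)
  moreover have "exp (- (norm x)\<^sup>2 / (2 * t)) = (\<Prod>i\<in>UNIV. exp (- (x $ i)\<^sup>2 / (2 * t)))"
    by (simp add: power2_norm_vec exp_sum[symmetric] sum_negf sum_divide_distrib)
  ultimately show ?thesis
    using assms by (simp add: heat_kernel_def normal_density_def prod.distrib prod_dividef prod_constant power_divide)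
qed

lemma has_sum_periodic_heat_kernel:
  fixes x :: "real ^ 'd"
  assumes "t > 0"
  shows "((\<lambda>n. heat_kernel t (x - lattice_vec n)) has_sum (\<Prod>i\<in>UNIV. theta (sqrt t) (x $ i))) UNIV"
  using has_sum_prod_vec[of "\<lambda>i n. normal_density 0 (sqrt t) (x $ i - of_int n)"] assms
    summable_on_theta
  by (simp add: heat_kernel_eq_prod lattice_vec_def theta_def)

lemma periodic_heat_kernel_eq_prod:
  fixes x :: "real ^ 'd"
  assumes "t > 0"
  shows "periodic_heat_kernel x t = (\<Prod>i\<in>UNIV. theta (sqrt t) (x $ i))"
  using has_sum_periodic_heat_kernel[OF assms, of x] by (simp add: periodic_heat_kernel_def infsumI)

section \<open>Bounds for \<open>1 / H\<close> at the arguments occurring in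
  \<open>U\<close>\<close>

lemma heat_kernel_le_periodic:
  fixes x :: "real ^ 'd"
  assumes "t > 0"
  shows "heat_kernel t (x - lattice_vec n) \<le> periodic_heat_kernel x t"
  using finite_sum_le_infsum[of "\<lambda>n. heat_kernel t (x - lattice_vec n)" UNIV "{n}"]
    has_sum_imp_summable[OF has_sum_periodic_heat_kernel[OF assms, of x]]
  by (simp add: periodic_heat_kernel_def heat_kernel_def)

lemma inverse_periodic_heat_kernel_le:
  fixes m :: "int ^ 'd" and z :: "real ^ 'd"
  defines "r \<equiv> norm (lattice_vec m)"
  defines "H \<equiv> \<lambda>s z. periodic_heat_kernel ((r / (2 * sqrt s)) *\<^sub>R z + (1 / 2) *\<^sub>R lattice_vec m) (r\<^sup>2 / (4 * s))"
  assumes "r > 0" "s > 0"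
  shows "0 < H s z"
    and "1 / H s z \<le> (pi * r\<^sup>2 / (2 * s)) powr (real CARD('d) / 2) * exp ((s + (norm z)\<^sup>2) / 2)"
proof -
  let ?v = "lattice_vec m" and ?t = "r\<^sup>2 / (4 * s)" and ?\<alpha> = "r / (2 * sqrt s)"
  let ?x = "?\<alpha> *\<^sub>R z + (1 / 2) *\<^sub>R ?v"
  have t: "?t > 0" using assms by simp
  \<comment> \<open>Used with \<open>c = 1 / 2\<close> for the lattice point 0 and
    \<open>c = - 1 / 2\<close> for \<open>m\<close>.\<close>
  have sq: "(norm (?\<alpha> *\<^sub>R z + c *\<^sub>R ?v))\<^sup>2 = r\<^sup>2 / (4 * s) * (norm z)\<^sup>2 + c\<^sup>2 * r\<^sup>2 + 2 * c * ?\<alpha> * (z \<bullet> ?v)"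
    for c
  proof -
    have "(norm (?\<alpha> *\<^sub>R z + c *\<^sub>R ?v))\<^sup>2 = ?\<alpha>\<^sup>2 * (norm z)\<^sup>2 + c\<^sup>2 * r\<^sup>2 + 2 * c * ?\<alpha> * (z \<bullet> ?v)"
      unfolding r_def power2_norm_eq_inner
      by (simp add: inner_commute inner_add power2_eq_square algebra_simps)
    moreover have "?\<alpha>\<^sup>2 = r\<^sup>2 / (4 * s)" using assms by (simp add: power_divide power_mult_distrib)
    ultimately show ?thesis by simp
  qed
  have "\<exists>n :: int ^ 'd. (norm (?x - lattice_vec n))\<^sup>2 \<le> r\<^sup>2 / (4 * s) * (norm z)\<^sup>2 + r\<^sup>2 / 4"
  proof (cases "z \<bullet> ?v \<le> 0")
    case True
    then have "?\<alpha> * (z \<bullet> ?v) \<le> 0" using assms by (intro mult_nonneg_nonpos) auto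
    moreover have "?x - lattice_vec 0 = ?\<alpha> *\<^sub>R z + (1 / 2) *\<^sub>R ?v"
      by (simp add: lattice_vec_def vec_eq_iff)
    ultimately show ?thesis
      using sq[of "1 / 2"] by (intro exI[of _ 0]) (simp add: power2_eq_square)
  next
    case False
    then have "(r * (z \<bullet> ?v)) / sqrt s \<ge> 0" using assms by auto
    then have "(norm (?\<alpha> *\<^sub>R z + (- 1 / 2) *\<^sub>R ?v))\<^sup>2 \<le> r\<^sup>2 / (4 * s) * (norm z)\<^sup>2 + r\<^sup>2 / 4"
      unfolding sq by (simp add: power2_eq_square)
    moreover have "?x - lattice_vec m = ?\<alpha> *\<^sub>R z + (- 1 / 2) *\<^sub>R ?v"
      by (simp add: vec_eq_iff algebra_simps)
    ultimately have "(norm (?x - lattice_vec m))\<^sup>2 \<le> r\<^sup>2 / (4 * s) * (norm z)\<^sup>2 + r\<^sup>2 / 4"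
      by (simp only:)
    then show ?thesis by blast
  qed
  then obtain n :: "int ^ 'd"
    where n: "(norm (?x - lattice_vec n))\<^sup>2 \<le> r\<^sup>2 / (4 * s) * (norm z)\<^sup>2 + r\<^sup>2 / 4" by blast
  \<comment> \<open>This is half of the exponent \<open>s + |z|^2\<close> in the weight of
    \<open>U\<close>, so the weight still decays after multiplication by the bound on
    \<open>1 / H\<close>.\<close>
  have "(norm (?x - lattice_vec n))\<^sup>2 / (2 * ?t) \<le> (s + (norm z)\<^sup>2) / 2"
    using n assms by (simp add: field_simps)
  then have "(2 * pi * ?t) powr (- real CARD('d) / 2) * exp (- ((s + (norm z)\<^sup>2) / 2))
      \<le> heat_kernel ?t (?x - lattice_vec n)"
    unfolding heat_kernel_def by (intro mult_left_mono) auto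
  also have "\<dots> \<le> H s z"
    unfolding H_def by (rule heat_kernel_le_periodic[OF t])
  finally have le: "(pi * r\<^sup>2 / (2 * s)) powr (- real CARD('d) / 2) * exp (- ((s + (norm z)\<^sup>2) / 2)) \<le> H s z"
    by (simp add: field_simps)
  have base: "0 < (pi * r\<^sup>2 / (2 * s)) powr (- real CARD('d) / 2) * exp (- ((s + (norm z)\<^sup>2) / 2))"
    using assms by simp
  with le show "0 < H s z" by linarith
  have "1 / H s z \<le> 1 / ((pi * r\<^sup>2 / (2 * s)) powr (- real CARD('d) / 2) * exp (- ((s + (norm z)\<^sup>2) / 2)))"
    using le base by (intro divide_left_mono) (auto intro: mult_pos_pos)
  also have "\<dots> = (pi * r\<^sup>2 / (2 * s)) powr (real CARD('d) / 2) * exp ((s + (norm z)\<^sup>2) / 2)"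
    by (simp add: powr_minus exp_minus field_simps)
  finally show "1 / H s z \<le> (pi * r\<^sup>2 / (2 * s)) powr (real CARD('d) / 2) * exp ((s + (norm z)\<^sup>2) / 2)" .
qed

lemma abs_one_minus_inverse_periodic_heat_kernel_le:
  "\<exists>K. \<forall>(m :: int ^ 'd) s z. lattice_vec m \<noteq> 0 \<longrightarrow> s > 0 \<longrightarrow>
     \<bar>1 - 1 / periodic_heat_kernel
        ((norm (lattice_vec m) / (2 * sqrt s)) *\<^sub>R z + (1 / 2) *\<^sub>R lattice_vec m)
        ((norm (lattice_vec m))\<^sup>2 / (4 * s))\<bar>
     \<le> K * (sqrt s / norm (lattice_vec m)) * exp ((s + (norm z)\<^sup>2) / 2)"
proof -
  \<comment> \<open>\<open>N\<close> comes from \<open>prod_close_1\<close>, \<open>B\<close> bounds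
    the power of \<open>pi * r^2 / (2 * s)\<close> once \<open>4 * N * \<rho> > 1\<close>, and
    \<open>K\<close> is large enough for both cases below.\<close>
  define N :: real where "N = 2 ^ CARD('d)"
  define B where "B = (8 * pi * N\<^sup>2) powr (real CARD('d) / 2)"
  define K where "K = 4 * N * (1 + B)"
  have N: "N \<ge> 1" by (simp add: N_def)
  have B: "B \<ge> 0" by (simp add: B_def)
  have "\<bar>1 - 1 / periodic_heat_kernel
        ((norm (lattice_vec m) / (2 * sqrt s)) *\<^sub>R z + (1 / 2) *\<^sub>R lattice_vec m)
        ((norm (lattice_vec m))\<^sup>2 / (4 * s))\<bar>
     \<le> K * (sqrt s / norm (lattice_vec m)) * exp ((s + (norm z)\<^sup>2) / 2)"
    if m: "lattice_vec m \<noteq> 0" and s: "s > 0" for m :: "int ^ 'd" and s z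
  proof -
    define r where "r = norm (lattice_vec m)"
    define \<rho> where "\<rho> = sqrt s / r"
    define t where "t = r\<^sup>2 / (4 * s)"
    define x where "x = (r / (2 * sqrt s)) *\<^sub>R z + (1 / 2) *\<^sub>R lattice_vec m"
    define H where "H = periodic_heat_kernel x t"
    define e where "e = exp ((s + (norm z)\<^sup>2) / 2)"
    have r: "r > 0" using m by (simp add: r_def)
    have \<rho>: "\<rho> > 0" using r s by (simp add: \<rho>_def)
    have t: "t > 0" using r s by (simp add: t_def)
    have e: "e \<ge> 1" using s by (simp add: e_def)
    have H: "0 < H" "1 / H \<le> (pi * r\<^sup>2 / (2 * s)) powr (real CARD('d) / 2) * e"
      using inverse_periodic_heat_kernel_le[of m s z] r s
      unfolding H_def x_def t_def r_def e_def by auto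
    have t_\<rho>: "r\<^sup>2 / s = 1 / \<rho>\<^sup>2" using r s by (simp add: \<rho>_def power_divide)
    have "2 * pi * t = pi / 2 * (1 / \<rho>\<^sup>2)" by (simp add: t_def t_\<rho>[symmetric])
    \<comment> \<open>Discarding the factor \<open>pi / 2\<close>, which is at least 1, leaves the
      clean bound \<open>1 / sqrt (2 * pi * t) <= \<rho>\<close>.\<close>
    also have "\<dots> \<ge> 1 * (1 / \<rho>\<^sup>2)" using pi_gt3 by (intro mult_right_mono) auto
    finally have "1 / \<rho> \<le> sqrt (2 * pi * t)"
      by (intro real_le_rsqrt) (simp add: power_divide)
    then have "2 / sqrt (2 * pi * (sqrt t)\<^sup>2) \<le> 2 * \<rho>"
      using \<rho> t by (simp add: divide_simps mult.commute)
    then have theta: "\<bar>theta (sqrt t) y - 1\<bar> \<le> 2 * \<rho>" for y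
      using theta_close_1[of "sqrt t" y] t by simp
    have "\<bar>1 - 1 / H\<bar> \<le> K * \<rho> * e"
    \<comment> \<open>Below this threshold \<open>|H - 1| <= 2 * N * \<rho> <= 1/2\<close>, which
      keeps \<open>H\<close> away from 0; it also gives \<open>2 * \<rho> \<le> 1\<close>, as
      \<open>prod_close_1\<close> requires.\<close>
    proof (cases "4 * N * \<rho> \<le> 1")
      case True
      have "4 * \<rho> \<le> 4 * N * \<rho>" using N \<rho> by simp
      with True \<rho> have "2 * \<rho> \<le> 1" by linarith
      then have "\<bar>H - 1\<bar> \<le> (N - 1) * (2 * \<rho>)"
        unfolding H_def N_def periodic_heat_kernel_eq_prod[OF t]
        by (intro prod_close_1) (use theta \<rho> \<open>2 * \<rho> \<le> 1\<close> in auto)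
      also have "\<dots> \<le> 2 * N * \<rho>" using \<rho> by (simp add: algebra_simps)
      finally have H1: "\<bar>H - 1\<bar> \<le> 2 * N * \<rho>" .
      then have H2: "H \<ge> 1 / 2" using True by linarith
      have "\<bar>1 - 1 / H\<bar> = \<bar>H - 1\<bar> / H" using H(1) by (simp add: abs_if field_simps)
      also have "\<dots> \<le> 2 * N * \<rho> / (1 / 2)" using H1 H2 by (intro frac_le) auto
      also have "\<dots> = 4 * N * 1 * \<rho> * 1" by simp
      also have "\<dots> \<le> K * \<rho> * e"
        unfolding K_def using N B \<rho> e by (intro mult_mono) auto
      finally show ?thesis .
    next
      case False
      then have "1 / \<rho> \<le> 4 * N" using \<rho> by (simp add: field_simps)
      then have "(1 / \<rho>)\<^sup>2 \<le> (4 * N)\<^sup>2" using \<rho> by (intro power_mono) auto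
      then have "pi / 2 * (r\<^sup>2 / s) \<le> pi / 2 * (16 * N\<^sup>2)"
        unfolding t_\<rho> by (intro mult_left_mono) (auto simp: power_mult_distrib power_divide)
      then have "pi * r\<^sup>2 / (2 * s) \<le> 8 * pi * N\<^sup>2" by simp
      then have "(pi * r\<^sup>2 / (2 * s)) powr (real CARD('d) / 2) \<le> B"
        unfolding B_def using s r by (intro powr_mono2) auto
      then have "1 / H \<le> B * e"
        using H(2) e by (meson mult_right_mono order_trans zero_le_one)
      moreover have "\<bar>1 - h\<bar> \<le> e + b" if "0 < h" "h \<le> b" for h b :: real
        using that e by (auto simp: abs_le_iff)
      ultimately have "\<bar>1 - 1 / H\<bar> \<le> 1 * ((1 + B) * e)"
        using H(1) by (simp add: distrib_right)
      \<comment> \<open>Here \<open>4 * N * \<rho>\<close> exceeds 1, so inserting it as a factor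
        gives the required form although \<open>1 / H\<close> is merely bounded by
        \<open>B * e\<close>.\<close>
      also have "\<dots> \<le> (4 * N * \<rho>) * ((1 + B) * e)"
        using False e B by (intro mult_right_mono) auto
      finally show ?thesis by (simp add: K_def mult_ac)
    qed
    then show ?thesis
      by (simp add: H_def x_def t_def r_def \<rho>_def e_def)
  qed
  then show ?thesis by blast
qed

section \<open>Gaussian and Gamma integrals, and the decay of \<open>U m + 1\<close>\<close>

lemma has_bochner_integral_heat_kernel:
  assumes "t > 0"
  shows "has_bochner_integral lborel (heat_kernel t :: real ^ 'd \<Rightarrow> real) 1"
proof (rule has_bochner_integral_nn_integral)
  let ?g = "normal_density 0 (sqrt t)"
  have prod: "heat_kernel t x = (\<Prod>b\<in>Basis. ?g (x \<bullet> b))" for x :: "real ^ 'd"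
  proof -
    have Basis: "(Basis :: (real ^ 'd) set) = range (\<lambda>i. axis i 1)"
      by (auto simp: Basis_vec_def)
    have "inj (\<lambda>i :: 'd. axis i (1 :: real))"
      by (auto simp: inj_def axis_eq_axis)
    then show ?thesis
      unfolding Basis heat_kernel_eq_prod[OF assms] by (subst prod.reindex) (auto simp: inner_axis)
  qed
  have "(\<integral>\<^sup>+y. ?g y \<partial>lborel) = 1"
    using assms by (subst nn_integral_eq_integral) auto
  then show "(\<integral>\<^sup>+x. heat_kernel t (x :: real ^ 'd) \<partial>lborel) = ennreal 1"
    unfolding prod using nn_integral_lborel_prod[of "\<lambda>_ y. ennreal (?g y)"]
    by (simp add: prod_ennreal)
  show "(heat_kernel t :: real ^ 'd \<Rightarrow> real) \<in> borel_measurable lborel"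
    unfolding heat_kernel_def by measurable
qed (simp_all add: heat_kernel_def)

lemma has_bochner_integral_gaussian:
  assumes "c > 0"
  shows "has_bochner_integral lborel (\<lambda>z :: real ^ 'd. exp (- (c * (norm z)\<^sup>2))) ((pi / c) powr (real CARD('d) / 2))"
proof -
  have "(pi / c) powr (real CARD('d) / 2) * heat_kernel (1 / (2 * c)) z = exp (- (c * (norm z)\<^sup>2))"
    for z :: "real ^ 'd"
    using assms by (simp add: heat_kernel_def powr_minus field_simps)
  then show ?thesis
    using has_bochner_integral_mult_right[of "(pi / c) powr (real CARD('d) / 2)",
        OF has_bochner_integral_heat_kernel[where ?'d = 'd, of "1 / (2 * c)"]] assms
    by simp
qed

text \<open>The real integrand is the modulus of the complex Gamma integrand, which is absolutely
  integrable; being Borel, it is also integrable with respect to \<open>lborel\<close>.\<close>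

lemma set_integrable_Gamma:
  fixes x a :: real
  assumes "x > 0" "a > 0"
  shows "set_integrable lborel {0<..} (\<lambda>s. s powr (x - 1) * exp (- (a * s)))"
proof -
  have "set_integrable lebesgue {0<..}
      (\<lambda>s. norm (complex_of_real s powr (complex_of_real x - 1) / of_real (exp (a * s))))"
    by (intro set_integrable_norm absolutely_integrable_Gamma_integral) (use assms in auto)
  also have "?this \<longleftrightarrow> set_integrable lebesgue {0<..} (\<lambda>s. s powr (x - 1) * exp (- (a * s)))"
    by (rule set_integrable_cong) (auto simp: norm_divide norm_powr_real_powr exp_minus field_simps)
  finally show ?thesis
    unfolding set_integrable_def by (subst (asm) integrable_completion) auto
qed

lemma set_integral_Gamma:
  fixes x :: real
  assumes "x > 0"
  shows "(LINT s:{0<..}|lborel. s powr (x - 1) * exp (- s)) = Gamma x"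
proof -
  have "((\<lambda>t. t powr (x - 1) / exp t) has_integral Gamma x) {0<..}"
    using Gamma_integral_real[OF assms]
    by (subst has_integral_spike_set_eq[of _ "{0..}"]) (auto intro: negligible_subset[of "{0}"])
  then have "integral {0<..} (\<lambda>s. s powr (x - 1) * exp (- s)) = Gamma x"
    by (simp add: exp_minus divide_inverse integral_unique)
  then show ?thesis
    using set_borel_integral_eq_integral(2)[OF set_integrable_Gamma[OF assms, of 1]] by simp
qed

text \<open>Writing \<open>F / H = F - D\<close> with \<open>D = F * (1 - 1 / H)\<close> separates
  the exact main term, whose integral cancels the 1, from a remainder that is \<open>1 / r\<close>
  times an integrable product of a function of \<open>s\<close> and one of \<open>z\<close>.\<close>

lemma abs_U_plus_1_le:
  "\<exists>C. \<forall>m :: int ^ 'd. lattice_vec m \<noteq> 0 \<longrightarrow> \<bar>U m + 1\<bar> \<le> C / norm (lattice_vec m)"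
proof -
  define d where "d = real CARD('d)"
  \<comment> \<open>\<open>gz\<close> and \<open>gs\<close> are what remains of the weights after
    the loss of \<open>exp ((s + |z|^2) / 2)\<close>; the factor \<open>sqrt s\<close> raises the
    power of \<open>s\<close> from \<open>d / 2\<close> to \<open>(d + 3) / 2 - 1\<close>.\<close>
  define gz where "gz = (\<lambda>z :: real ^ 'd. exp (- ((1 / 2) * (norm z)\<^sup>2)))"
  define gs where "gs = (\<lambda>s :: real. s powr ((d + 3) / 2 - 1) * exp (- ((1 / 2) * s)))"
  obtain K where K: "\<And>(m :: int ^ 'd) s z. lattice_vec m \<noteq> 0 \<Longrightarrow> s > 0 \<Longrightarrow>
     \<bar>1 - 1 / periodic_heat_kernel
        ((norm (lattice_vec m) / (2 * sqrt s)) *\<^sub>R z + (1 / 2) *\<^sub>R lattice_vec m)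
        ((norm (lattice_vec m))\<^sup>2 / (4 * s))\<bar>
     \<le> K * (sqrt s / norm (lattice_vec m)) * exp ((s + (norm z)\<^sup>2) / 2)"
    using abs_one_minus_inverse_periodic_heat_kernel_le[where ?'d = 'd] by blast
  define G where "G = pi powr (d / 2) * Gamma ((d + 2) / 2)"
  define C where "C = K * integral\<^sup>L lborel gz * (LINT s:{0<..}|lborel. gs s) / G"
  have d: "d > 0" by (simp add: d_def)
  have G: "G > 0" using d by (simp add: G_def Gamma_real_pos)
  have gz: "integrable lborel gz"
    using has_bochner_integral_gaussian[of "1 / 2"] by (auto simp: gz_def has_bochner_integral_iff)
  have gs: "set_integrable lborel {0<..} gs"
    unfolding gs_def using d by (intro set_integrable_Gamma) auto
  have "\<bar>U m + 1\<bar> \<le> C / norm (lattice_vec m)" if m: "lattice_vec m \<noteq> 0" for m :: "int ^ 'd"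
  proof -
    define r where "r = norm (lattice_vec m)"
    define H where "H = (\<lambda>s z. periodic_heat_kernel
        ((r / (2 * sqrt s)) *\<^sub>R z + (1 / 2) *\<^sub>R lattice_vec m) (r\<^sup>2 / (4 * s)))"
    define F where "F = (\<lambda>s (z :: real ^ 'd). s powr (d / 2) * exp (- s - (norm z)\<^sup>2))"
    \<comment> \<open>The cut-off lies outside the range of integration and makes \<open>D\<close>
      manageable as a function on the whole product space.\<close>
    define D where "D = (\<lambda>s z. if s > 0 then F s z * (1 - 1 / H s z) else 0)"
    define B where "B = (\<lambda>s. \<integral>z. D s z \<partial>lborel)"
    have r: "r > 0" using m by (simp add: r_def)
    \<comment> \<open>The value 1 for \<open>s \<le> 0\<close> makes the first argument of \<open>theta\<close> positive everywhere, as the measurability rule requires.\<close>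
    have D_eq: "D s z = (if s > 0 then F s z * (1 - 1 / (\<Prod>i\<in>UNIV.
        theta (if s > 0 then sqrt (r\<^sup>2 / (4 * s)) else 1)
          (((r / (2 * sqrt s)) *\<^sub>R z + (1 / 2) *\<^sub>R lattice_vec m) $ i))) else 0)" for s z
      using r by (simp add: D_def H_def periodic_heat_kernel_eq_prod)
    \<comment> \<open>Joint measurability is what makes the parameter integral \<open>B\<close>
      measurable in \<open>s\<close>.\<close>
    have [measurable]: "case_prod D \<in> borel_measurable (lborel \<Otimes>\<^sub>M lborel)"
    proof -
      have vec_nth [measurable]: "(\<lambda>z :: real ^ 'd. z $ i) \<in> borel_measurable borel" for i
        by (intro borel_measurable_continuous_onI continuous_intros)
      have pos [simp]: "0 < (if 0 < s then sqrt (r\<^sup>2 / (4 * s)) else 1)" for s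
        using r by simp
      show ?thesis
        unfolding D_eq F_def case_prod_beta vector_add_component vector_scaleR_component
        by measurable
    qed
    have [measurable]: "D s \<in> borel_measurable lborel" for s by measurable
    have [measurable]: "B \<in> borel_measurable lborel" unfolding B_def by measurable
    have D_le: "\<bar>D s z\<bar> \<le> (K / r * gs s) * gz z" if "s > 0" for s z
    proof -
      have "\<bar>D s z\<bar> = F s z * \<bar>1 - 1 / H s z\<bar>"
        using that by (simp add: D_def abs_mult F_def)
      also have "\<dots> \<le> F s z * (K * (sqrt s / r) * exp ((s + (norm z)\<^sup>2) / 2))"
        using K[OF m that, of z] by (intro mult_left_mono) (auto simp: H_def r_def F_def)
      also have "s powr (d / 2) * sqrt s = s powr ((d + 3) / 2 - 1)"
        using that by (simp add: powr_half_sqrt[symmetric] powr_add[symmetric] field_simps)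
      then have "F s z * (K * (sqrt s / r) * exp ((s + (norm z)\<^sup>2) / 2)) =
          K / r * s powr ((d + 3) / 2 - 1) *
          (exp (- s - (norm z)\<^sup>2) * exp ((s + (norm z)\<^sup>2) / 2))"
        by (simp add: F_def mult_ac)
      also have "exp (- s - (norm z)\<^sup>2) * exp ((s + (norm z)\<^sup>2) / 2)
          = exp (- ((1 / 2) * s)) * exp (- ((1 / 2) * (norm z)\<^sup>2))"
        by (simp add: exp_add[symmetric] field_simps)
      finally show ?thesis by (simp add: gs_def gz_def mult_ac)
    qed
    \<comment> \<open>Integrability allows the inner integral of \<open>F - D\<close> to be
      split.\<close>
    have D_int: "integrable lborel (D s)" if "s > 0" for s
      by (rule Bochner_Integration.integrable_bound[OF integrable_mult_right[OF gz, of "K / r * gs s"]])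
         (measurable, unfold real_norm_def, intro AE_I2 order_trans[OF D_le[OF that] abs_ge_self])
    have B_le: "\<bar>B s\<bar> \<le> K * integral\<^sup>L lborel gz / r * gs s" if "s > 0" for s
    proof -
      have "\<bar>B s\<bar> \<le> (\<integral>z. (K / r * gs s) * gz z \<partial>lborel)"
        unfolding B_def using D_le[OF that] D_int[OF that] gz
        by (intro integral_abs_bound_integral) auto
      then show ?thesis by (simp add: mult_ac)
    qed
    have F: "has_bochner_integral lborel (F s) (pi powr (d / 2) * (s powr ((d + 2) / 2 - 1) * exp (- s)))" for s
    proof -
      have "F s = (\<lambda>z. (s powr (d / 2) * exp (- s)) * exp (- (1 * (norm z)\<^sup>2)))"
        by (simp add: F_def exp_diff exp_minus fun_eq_iff field_simps)
      moreover have "(d + 2) / 2 - 1 = d / 2" by (simp add: field_simps)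
      ultimately show ?thesis
        unfolding \<open>(d + 2) / 2 - 1 = d / 2\<close>
        using has_bochner_integral_mult_right[of "s powr (d / 2) * exp (- s)",
            OF has_bochner_integral_gaussian[where ?'d = 'd, of 1]]
        by (simp add: d_def mult_ac)
    qed
    have inner: "(\<integral>z. F s z / H s z \<partial>lborel)
        = pi powr (d / 2) * (s powr ((d + 2) / 2 - 1) * exp (- s)) - B s" if "s > 0" for s
    proof -
      have "(\<integral>z. F s z / H s z \<partial>lborel) = (\<integral>z. F s z - D s z \<partial>lborel)"
        using that by (intro Bochner_Integration.integral_cong) (auto simp: D_def algebra_simps)
      also have "\<dots> = (\<integral>z. F s z \<partial>lborel) - B s"
        unfolding B_def using F[of s] D_int[OF that]
        by (intro Bochner_Integration.integral_diff) (auto simp: has_bochner_integral_iff)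
      finally show ?thesis using F[of s] by (simp add: has_bochner_integral_iff)
    qed
    have dom: "set_integrable lborel {0<..} (\<lambda>s. K * integral\<^sup>L lborel gz / r * gs s)"
      using gs by (intro set_integrable_mult_right) auto
    have B_int: "set_integrable lborel {0<..} B"
      by (rule set_integrable_bound[OF dom])
         (simp add: set_borel_measurable_def, unfold real_norm_def,
           intro AE_I2 impI order_trans[OF B_le abs_ge_self], simp)
    have "(LINT s:{0<..}|lborel. (\<integral>z. F s z / H s z \<partial>lborel))
        = (LINT s:{0<..}|lborel. pi powr (d / 2) * (s powr ((d + 2) / 2 - 1) * exp (- s)) - B s)"
      using inner by (intro set_lebesgue_integral_cong) auto
    also have "\<dots> = (LINT s:{0<..}|lborel. pi powr (d / 2) * (s powr ((d + 2) / 2 - 1) * exp (- s)))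
        - (LINT s:{0<..}|lborel. B s)"
      using set_integrable_Gamma[of "(d + 2) / 2" 1] d B_int
      by (intro set_integral_diff set_integrable_mult_right) auto
    \<comment> \<open>The Gaussian factor \<open>pi powr (d / 2)\<close> and the Gamma integral
      multiply to exactly the normalising constant of \<open>U\<close>.\<close>
    also have "\<dots> = G - (LINT s:{0<..}|lborel. B s)"
      using set_integral_Gamma[of "(d + 2) / 2"] d by (simp add: G_def)
    finally have "U m = - (1 / G) * (G - (LINT s:{0<..}|lborel. B s))"
      by (simp add: U_def G_def F_def H_def d_def r_def)
    then have "U m + 1 = (LINT s:{0<..}|lborel. B s) / G"
      using G by (simp add: field_simps)
    moreover have "\<bar>LINT s:{0<..}|lborel. B s\<bar> \<le> (LINT s:{0<..}|lborel. K * integral\<^sup>L lborel gz / r * gs s)"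
      unfolding set_lebesgue_integral_def
      using B_int dom B_le unfolding set_integrable_def
      by (intro integral_abs_bound_integral) (auto simp: indicator_def)
    moreover have "(LINT s:{0<..}|lborel. K * integral\<^sup>L lborel gz / r * gs s)
        = K * integral\<^sup>L lborel gz / r * (LINT s:{0<..}|lborel. gs s)"
      by (rule set_integral_mult_right)
    ultimately have "\<bar>U m + 1\<bar> \<le> K * integral\<^sup>L lborel gz / r * (LINT s:{0<..}|lborel. gs s) / G"
      using G by (simp add: divide_right_mono del: divide_divide_eq_left)
    then show ?thesis by (simp add: C_def r_def mult.commute)
  qed
  then show ?thesis by blast
qed

section \<open>Summability over the lattice and the final estimate\<close>

lemma summable_on_int_powr:
  assumes "p > 1"
  shows "(\<lambda>k::int. (1 + \<bar>real_of_int k\<bar>) powr (- p)) summable_on UNIV"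
proof -
  have "summable (\<lambda>k. real k powr (- p))" using assms by (simp add: summable_real_powr_iff)
  then have 1: "summable (\<lambda>k. (1 + real k) powr (- p))"
    using summable_Suc_iff[of "\<lambda>k. real k powr (- p)"] by (simp add: add.commute)
  then have 2: "summable (\<lambda>k. (2 + real k) powr (- p))"
    using summable_Suc_iff[of "\<lambda>k. (1 + real k) powr (- p)"] by (simp add: add.commute)
  \<comment> \<open>The halves of the integers: \<open>1 + |n|\<close> is \<open>1 + k\<close> for
    \<open>n = k\<close> and \<open>2 + k\<close> for \<open>n = - 1 - k\<close>.\<close>
  have "(\<lambda>k. (1 + real k) powr (- p)) summable_on UNIV" "(\<lambda>k. (2 + real k) powr (- p)) summable_on UNIV"
    using 1 2 by (auto intro!: norm_summable_imp_summable_on)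
  then show ?thesis
    using has_sum_int_split[of "\<lambda>k::int. (1 + \<bar>real_of_int k\<bar>) powr (- p)" 0] 
    by (force simp: summable_on_def)
qed

lemma summable_on_lattice_norm:
  "(\<lambda>m :: int ^ 'd. 1 / norm (lattice_vec m) ^ (CARD('d) + 1)) summable_on UNIV"
proof -
  \<comment> \<open>Chosen so that \<open>p > 1\<close> while \<open>p * CARD('d)\<close> is exactly
    \<open>CARD('d) + 1\<close>: the \<open>d\<close> factors \<open>(2 * r) powr (- p)\<close>
    multiply to the required power of \<open>2 * r\<close>.\<close>
  define p where "p = 1 + 1 / real CARD('d)"
  let ?f = "\<lambda>m :: int ^ 'd. \<Prod>i\<in>UNIV. (1 + \<bar>real_of_int (m $ i)\<bar>) powr (- p)"
  have p: "p > 1" by (simp add: p_def)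
  have "(\<lambda>m. 2 ^ (CARD('d) + 1) * ?f m) summable_on UNIV"
    using has_sum_prod_vec[of "\<lambda>_ :: 'd. \<lambda>k. (1 + \<bar>real_of_int k\<bar>) powr (- p)"]
      summable_on_int_powr[OF p]
    by (intro summable_on_cmult_right) (auto simp: summable_on_def)
  then show ?thesis
  proof (rule summable_on_comparison_test)
    fix m :: "int ^ 'd"
    define r where "r = norm (lattice_vec m)"
    show "1 / norm (lattice_vec m) ^ (CARD('d) + 1) \<le> 2 ^ (CARD('d) + 1) * ?f m"
    proof (cases "m = 0")
      case True
      \<comment> \<open>The left-hand side is \<open>1 / 0 = 0\<close> here.\<close>
      then have "lattice_vec m = 0" by (simp add: lattice_vec_def vec_eq_iff)
      then show ?thesis by (simp add: prod_nonneg)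
    next
      case False
      have comp: "\<bar>real_of_int (m $ i)\<bar> \<le> r" for i
        using component_le_norm_cart[of "lattice_vec m" i] by (simp add: r_def lattice_vec_def)
      obtain i where "m $ i \<noteq> 0" using False by (auto simp: vec_eq_iff)
      then have "1 \<le> \<bar>real_of_int (m $ i)\<bar>" by linarith
      with comp[of i] have r: "1 \<le> r" by linarith
      have "(1 / (2 * r)) ^ (CARD('d) + 1) = (\<Prod>i\<in>(UNIV :: 'd set). (2 * r) powr (- p))"
      proof -
        have "(\<Prod>i\<in>(UNIV :: 'd set). (2 * r) powr (- p)) = (2 * r) powr (- p * real CARD('d))"
          using r by (simp add: powr_power mult.commute)
        also have "- p * real CARD('d) = - real (CARD('d) + 1)" by (simp add: p_def field_simps)
        also have "(2 * r) powr \<dots> = (1 / (2 * r)) ^ (CARD('d) + 1)"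
          using r by (simp only: powr_minus powr_realpow) (simp add: field_simps)
        finally show ?thesis by simp
      qed
      also have "\<dots> \<le> ?f m"
      proof (rule prod_mono, safe)
        fix i
        \<comment> \<open>Since \<open>r \<ge> 1\<close>, \<open>1 + |m_i| <= 2 * r\<close>.\<close>
        show "(2 * r) powr (- p) \<le> (1 + \<bar>real_of_int (m $ i)\<bar>) powr (- p)"
          using comp[of i] r p by (intro powr_mono2') auto
      qed simp
      finally have "1 / (2 ^ (CARD('d) + 1) * r ^ (CARD('d) + 1)) \<le> ?f m"
        by (simp only: power_divide power_mult_distrib power_one)
      then show ?thesis
        using r mult_left_mono[of "1 / (2 ^ (CARD('d) + 1) * r ^ (CARD('d) + 1))" "?f m" "2 ^ (CARD('d) + 1)"]
        unfolding r_def[symmetric] by (simp del: power_Suc)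
    qed
  qed simp
qed

theorem corollary3p7:
  assumes "CARD('d::finite) \<ge> 2"
  shows "\<exists>C::real. \<forall>j k :: 'd.
           (\<lambda>m :: int ^ 'd. \<bar>J_kernel j k m\<bar>) summable_on UNIV \<and>
           (\<Sum>\<^sub>\<infinity>m. \<bar>J_kernel j k m\<bar>) \<le> C"
proof -
  obtain C where C: "\<And>m :: int ^ 'd. lattice_vec m \<noteq> 0 \<Longrightarrow> \<bar>U m + 1\<bar> \<le> C / norm (lattice_vec m)"
    using abs_U_plus_1_le[where ?'d = 'd] by blast
  define g where "g = (\<lambda>m :: int ^ 'd. \<bar>c_const CARD('d)\<bar> * \<bar>C\<bar> * (1 / norm (lattice_vec m) ^ (CARD('d) + 1)))"
  have g: "g summable_on UNIV"
    unfolding g_def using summable_on_lattice_norm by (intro summable_on_cmult_right) auto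
  have le: "\<bar>J_kernel j k m\<bar> \<le> g m" for j k :: 'd and m
  proof (cases "m = 0")
    case True
    then show ?thesis by (simp add: J_kernel_def g_def)
  next
    case False
    define r where "r = norm (lattice_vec m)"
    have m: "lattice_vec m \<noteq> 0" using False by (auto simp: lattice_vec_def vec_eq_iff)
    then have r: "r > 0" by (simp add: r_def)
    have comp: "\<bar>real_of_int (m $ i)\<bar> \<le> r" for i
      using component_le_norm_cart[of "lattice_vec m" i] by (simp add: r_def lattice_vec_def)
    have "\<bar>J_kernel j k m\<bar> = \<bar>c_const CARD('d)\<bar> *
        (\<bar>real_of_int (m $ j)\<bar> * \<bar>real_of_int (m $ k)\<bar> / r ^ (CARD('d) + 2)) * \<bar>U m + 1\<bar>"
      using False r by (simp add: J_kernel_def abs_mult r_def)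
    \<comment> \<open>The two components cancel two powers of \<open>r\<close>, and the decay of
      \<open>U m + 1\<close> contributes one more, leaving \<open>r ^ (CARD('d) + 1)\<close> in the
      denominator.\<close>
    also have "\<dots> \<le> \<bar>c_const CARD('d)\<bar> * (r * r / r ^ (CARD('d) + 2)) * (\<bar>C\<bar> / r)"
      using comp[of j] comp[of k] r C[OF m]
      by (intro mult_mono divide_right_mono)
         (auto simp: r_def intro: order_trans[OF _ divide_right_mono[OF abs_ge_self]])
    also have "\<dots> = g m" using r by (simp add: g_def r_def[symmetric] field_simps)
    finally show ?thesis .
  qed
  have "(\<lambda>m. \<bar>J_kernel j k m\<bar>) summable_on UNIV" for j k :: 'd
    using g by (rule summable_on_comparison_test) (use le in auto)
  \<comment> \<open>The majorant \<open>g\<close> does not depend on \<open>j\<close> and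
    \<open>k\<close>, so its sum is a constant for all pairs.\<close>
  moreover from this have "(\<Sum>\<^sub>\<infinity>m. \<bar>J_kernel j k m\<bar>) \<le> infsum g UNIV" for j k :: 'd
    using g le by (intro infsum_mono) auto
  ultimately show ?thesis by blast
qed

end
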